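(* (FKG inequality) Let $(p_k)_{k\ge0}$ be a probability distribution on $\mathbb N=\{0,1,2,\dots\}$ with $p_0>0$ and $p_0+p_1<1$. Let $n\ge0$, $x\in\{1,2,\dots\}$, $\beta\ge0$, and let $\varphi:(\{-1\}\cup\mathbb N)^2\to\mathbb R$ satisfy, for all $X,Y,X',Y'\in\{-1\}\cup\mathbb N$, $$\varphi(X,Y)+\varphi(X',Y')\ \ge\ \varphi(X\wedge X',Y\wedge Y')+\varphi(X\vee X',Y\vee Y'),$$ where $\wedge$ and $\vee$ denote minimum and maximum. Let $\mathbb E_n^x$ be the expectation of the interacting tree model with pair interaction $\varphi$ defined in the context (assuming its partition function $\Xi_n^x$ is finite). Then for any non-decreasing functions $F,G:\Omega_n\to\mathbb R$ (such that $F$, $G$ and $FG$ are integrable), $$\mathbb E_n^x(FG)-(\mathbb E_n^xF)(\mathbb E_n^xG)\ge0.$$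
   Context: Trees. $\mathcal T_n$ is the set of planar rooted trees whose nodes $i\in\omega$ are at distance $|i|\le n$ from the root, each node $i\in\omega$ having a number of offspring $X_i=X_i(\omega)\in\mathbb N$ (the offspring of nodes at distance exactly $n$ are counted but are not themselves nodes of $\omega$). Nodes are labelled by Neveu labels: the root is $0$; a node at distance $n'\ge1$ has label $i=i_1i_2\dots i_{n'}$ with $i_j\in\{1,2,\dots\}$, meaning it is the $i_{n'}$-th child of $i_1\dots i_{n'-1}$ (of the root if $n'=1$). $a(i)$ denotes the parent of $i$, and $X_{a(0)}:=x$ is a prescribed boundary condition. Measure: $\mathbb P^{GW}(\omega)=\prod_{i\in\omega}p_{X_i(\omega)}$, $H_n^x(\omega)=\sum_{i\in\omega}\varphi(X_{a(i)},X_i)$ (the root contributes $\varphi(x,X_0)$), $\Xi_n^x=\sum_{\omega\in\mathcal T_n}\mathbb P^{GW}(\omega)e^{-\beta H_n^x(\omega)}$, $\mathbb P_n^x(\omega)=(\Xi_n^x)^{-1}\mathbb P^{GW}(\omega)e^{-\beta H_n^x(\omega)}$, and $\mathbb E_n^x$ is the expectation under $\mathbb P_n^x$. Spin representation: $\Lambda_n=\bigcup_{n'=0}^n\{1,2,\dots\}^{n'}$ (with $\{1,2,\dots\}^0=\{0\}$) is the set of all possible Neveu labels up to generation $n$, and $\Omega_n=(\{-1\}\cup\mathbb N)^{\Lambda_n}$. A tree $\omega\in\mathcal T_n$ is identified with the configuration $\chi(\omega)=(X_i)_{i\in\Lambda_n}\in\Omega_n$ where $X_i=X_i(\omega)$ if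 $i\in\omega$ and $X_i=-1$ if $i\notin\omega$; for $F:\Omega_n\to\mathbb R$, $\mathbb E_n^xF$ means $\sum_{\omega\in\mathcal T_n}\mathbb P_n^x(\omega)F(\chi(\omega))$. $\Omega_n$ carries the partial order $\chi\ge\chi'$ iff $X_i\ge X_i'$ for all $i\in\Lambda_n$; $F$ is non-decreasing if $\chi\ge\chi'$ implies $F(\chi)\ge F(\chi')$. *)

theory Defs
  imports "HOL-Probability.Probability_Mass_Function"
begin

text \<open>
  A node is its Neveu label, a word over the positive integers; the root is the empty word, the
  \<open>j\<close>-th child of \<open>i\<close> is \<open>i @ [j]\<close>, and the parent of a node other than the root is \<open>butlast i\<close>.
\<close>

definition labels :: "nat \<Rightarrow> nat list set" where
  "labels n = {i \<in> lists {1..}. length i \<le> n}"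

text \<open>
  A tree is a partial map whose domain is the set of nodes and which sends each node to its number
  of offspring. Nodes at distance \<open>n\<close> from the root carry an offspring number, but their children
  are not nodes.
\<close>

definition trees :: "nat \<Rightarrow> (nat list \<rightharpoonup> nat) set" where
  "trees n = {\<omega>. [] \<in> dom \<omega> \<and> dom \<omega> \<subseteq> labels n \<and>
     (\<forall>i j. i @ [j] \<in> labels n \<longrightarrow>
        (i @ [j] \<in> dom \<omega> \<longleftrightarrow> (\<exists>k. \<omega> i = Some k \<and> j \<le> k)))}"

text \<open>The products and sums over \<open>dom \<omega>\<close> below are finite by the following fact.\<close>

lemma finite_dom_tree:
  assumes "\<omega> \<in> trees n"
  shows "finite (dom \<omega>)"
proof -
  have fin: "finite {i \<in> dom \<omega>. length i = m}" for m
  proof (induction m)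
    case 0
    have "{i \<in> dom \<omega>. length i = 0} \<subseteq> {[]}" by auto
    then show ?case using finite_subset by blast
  next
    case (Suc m)
    let ?A = "{i \<in> dom \<omega>. length i = m}"
    have "{i \<in> dom \<omega>. length i = Suc m} \<subseteq> (\<Union>i\<in>?A. (\<lambda>j. i @ [j]) ` {..the (\<omega> i)})"
    proof
      fix l assume l: "l \<in> {i \<in> dom \<omega>. length i = Suc m}"
      then have "l \<noteq> []" by auto
      then obtain i j where ij: "l = i @ [j]" by (metis append_butlast_last_id)
      with l assms obtain k where "\<omega> i = Some k" "j \<le> k"
        unfolding trees_def by blast
      then show "l \<in> (\<Union>i\<in>?A. (\<lambda>j. i @ [j]) ` {..the (\<omega> i)})"
        using l ij by force
    qed
    then show ?case using Suc.IH by (meson finite_UN_I finite_atMost finite_imageI finite_subset)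
  qed
  have "dom \<omega> \<subseteq> (\<Union>m\<le>n. {i \<in> dom \<omega>. length i = m})"
    using assms by (auto simp: trees_def labels_def)
  then show ?thesis using fin by (meson finite_UN_I finite_atMost finite_subset)
qed

definition offspring :: "(nat list \<rightharpoonup> nat) \<Rightarrow> nat list \<Rightarrow> nat" where
  "offspring \<omega> i = the (\<omega> i)"

definition parent_offspring :: "nat \<Rightarrow> (nat list \<rightharpoonup> nat) \<Rightarrow> nat list \<Rightarrow> nat" where
  "parent_offspring x \<omega> i = (if i = [] then x else offspring \<omega> (butlast i))"

definition GW_weight :: "nat pmf \<Rightarrow> (nat list \<rightharpoonup> nat) \<Rightarrow> real" where
  "GW_weight p \<omega> = (\<Prod>i\<in>dom \<omega>. pmf p (offspring \<omega> i))"

text \<open>The spin space \<open>{-1} \<union> \<nat>\<close> is the set of integers \<open>{-1..}\<close>.\<close>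

definition energy :: "(int \<Rightarrow> int \<Rightarrow> real) \<Rightarrow> nat \<Rightarrow> (nat list \<rightharpoonup> nat) \<Rightarrow> real" where
  "energy \<phi> x \<omega> =
     (\<Sum>i\<in>dom \<omega>. \<phi> (int (parent_offspring x \<omega> i)) (int (offspring \<omega> i)))"

definition boltzmann_weight ::
    "nat pmf \<Rightarrow> (int \<Rightarrow> int \<Rightarrow> real) \<Rightarrow> real \<Rightarrow> nat \<Rightarrow> (nat list \<rightharpoonup> nat) \<Rightarrow> real" where
  "boltzmann_weight p \<phi> \<beta> x \<omega> = GW_weight p \<omega> * exp (- \<beta> * energy \<phi> x \<omega>)"

definition finite_partition_function ::
    "nat pmf \<Rightarrow> (int \<Rightarrow> int \<Rightarrow> real) \<Rightarrow> real \<Rightarrow> nat \<Rightarrow> nat \<Rightarrow> bool" where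
  "finite_partition_function p \<phi> \<beta> n x \<longleftrightarrow> boltzmann_weight p \<phi> \<beta> x summable_on trees n"

definition partition_function ::
    "nat pmf \<Rightarrow> (int \<Rightarrow> int \<Rightarrow> real) \<Rightarrow> real \<Rightarrow> nat \<Rightarrow> nat \<Rightarrow> real" where
  "partition_function p \<phi> \<beta> n x = (\<Sum>\<^sub>\<infinity>\<omega>\<in>trees n. boltzmann_weight p \<phi> \<beta> x \<omega>)"

definition tree_prob ::
    "nat pmf \<Rightarrow> (int \<Rightarrow> int \<Rightarrow> real) \<Rightarrow> real \<Rightarrow> nat \<Rightarrow> nat \<Rightarrow> (nat list \<rightharpoonup> nat) \<Rightarrow> real" where
  "tree_prob p \<phi> \<beta> n x \<omega> = boltzmann_weight p \<phi> \<beta> x \<omega> / partition_function p \<phi> \<beta> n x"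

definition configs :: "nat \<Rightarrow> (nat list \<Rightarrow> int) set" where
  "configs n = (labels n \<rightarrow>\<^sub>E {-1..})"

definition config_le :: "nat \<Rightarrow> (nat list \<Rightarrow> int) \<Rightarrow> (nat list \<Rightarrow> int) \<Rightarrow> bool" where
  "config_le n \<sigma> \<sigma>' \<longleftrightarrow> (\<forall>i\<in>labels n. \<sigma> i \<le> \<sigma>' i)"

definition tree_config :: "nat \<Rightarrow> (nat list \<rightharpoonup> nat) \<Rightarrow> (nat list \<Rightarrow> int)" where
  "tree_config n \<omega> = (\<lambda>i\<in>labels n. if i \<in> dom \<omega> then int (offspring \<omega> i) else -1)"

text \<open>
  \<open>infsum\<close> is \<open>0\<close> for non-summable families, so expectations are meaningful only for integrable
  functions; for real families \<open>summable_on\<close> is absolute summability.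
\<close>

definition tree_integrable ::
    "nat pmf \<Rightarrow> (int \<Rightarrow> int \<Rightarrow> real) \<Rightarrow> real \<Rightarrow> nat \<Rightarrow> nat \<Rightarrow> ((nat list \<Rightarrow> int) \<Rightarrow> real) \<Rightarrow> bool" where
  "tree_integrable p \<phi> \<beta> n x F \<longleftrightarrow>
     (\<lambda>\<omega>. tree_prob p \<phi> \<beta> n x \<omega> * F (tree_config n \<omega>)) summable_on trees n"

definition tree_expectation ::
    "nat pmf \<Rightarrow> (int \<Rightarrow> int \<Rightarrow> real) \<Rightarrow> real \<Rightarrow> nat \<Rightarrow> nat \<Rightarrow> ((nat list \<Rightarrow> int) \<Rightarrow> real) \<Rightarrow> real" where
  "tree_expectation p \<phi> \<beta> n x F =
     (\<Sum>\<^sub>\<infinity>\<omega>\<in>trees n. tree_prob p \<phi> \<beta> n x \<omega> * F (tree_config n \<omega>))"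

end

theory Submission
  imports Defs "HOL-Library.Option_ord"
begin

text \<open>
  With an absent node below every offspring number, trees are closed under pointwise minimum and
  maximum, and the Boltzmann weight is log-supermodular on this distributive lattice. The only
  delicate nodes are those present in just one of two trees: their parent has strictly more
  offspring in that tree than in the other one (or is absent from the other one), so it keeps its
  offspring number in the join. The set of trees below a given tree is a finite lattice, where the
  FKG inequality follows from Birkhoff's representation and the four functions theorem of Ahlswede
  and Daykin; these finite lattices exhaust all trees.
\<close>

section \<open>The FKG inequality on distributive lattices\<close>

text \<open>The one-element case. The products with equal indices are bounded directly by the
  hypotheses, so only the sum of the two mixed products needs an argument.\<close>

lemma four_functions_two_point:
  fixes a0 a1 b0 b1 c0 c1 d0 d1 :: real
  assumes nonneg: "a0 \<ge> 0" "a1 \<ge> 0" "b0 \<ge> 0" "b1 \<ge> 0" "c0 \<ge> 0" "c1 \<ge> 0" "d0 \<ge> 0" "d1 \<ge> 0"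
    and le: "a0 * b0 \<le> c0 * d0" "a0 * b1 \<le> c1 * d0" "a1 * b0 \<le> c1 * d0" "a1 * b1 \<le> c1 * d1"
  shows "(a0 + a1) * (b0 + b1) \<le> (c0 + c1) * (d0 + d1)"
proof -
  define s t u v where "s = c0 * d1" and "t = c1 * d0" and "u = a0 * b1" and "v = a1 * b0"
  \<comment> \<open>Both \<open>u\<close> and \<open>v\<close> are at most \<open>t\<close>, and
    \<open>u * v \<le> t * s\<close>. Expanding \<open>(t - u) * (t - v) \<ge> 0\<close> gives the
    claim multiplied by \<open>t\<close>, hence the separate case \<open>t = 0\<close>.\<close>
  have "u + v \<le> t + s"
  proof (cases "t = 0")
    case True
    then have "u \<le> 0" "v \<le> 0" using le unfolding t_def u_def v_def by linarith+
    moreover have "s \<ge> 0" using nonneg by (simp add: s_def)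
    ultimately show ?thesis using True by simp
  next
    case False
    then have t: "t > 0" using nonneg by (simp add: t_def less_le)
    have "u * v = (a0 * b0) * (a1 * b1)" by (simp add: u_def v_def)
    also have "\<dots> \<le> (c0 * d0) * (c1 * d1)" by (intro mult_mono[of "a0 * b0"]) (use le nonneg in auto)
    also have "\<dots> = t * s" by (simp add: s_def t_def)
    finally have "u * v \<le> t * s" .
    moreover have "(t - u) * (t - v) \<ge> 0" using le by (simp add: t_def u_def v_def)
    ultimately have "t * (u + v) \<le> t * (t + s)" by (simp add: algebra_simps)
    then show ?thesis using t by simp
  qed
  then show ?thesis using le by (simp add: s_def t_def u_def v_def algebra_simps)
qed

text \<open>Induction on \<open>S\<close>: adding the values with and without the new element turns
  the four functions into functions on \<open>Pow S\<close>, and the two-point case shows that these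
  again satisfy the hypothesis.\<close>

lemma four_functions:
  fixes f1 f2 f3 f4 :: "'a set \<Rightarrow> real"
  assumes "finite S"
    and "\<And>A. A \<subseteq> S \<Longrightarrow> f1 A \<ge> 0" "\<And>A. A \<subseteq> S \<Longrightarrow> f2 A \<ge> 0"
    and "\<And>A. A \<subseteq> S \<Longrightarrow> f3 A \<ge> 0" "\<And>A. A \<subseteq> S \<Longrightarrow> f4 A \<ge> 0"
    and "\<And>A B. A \<subseteq> S \<Longrightarrow> B \<subseteq> S \<Longrightarrow> f1 A * f2 B \<le> f3 (A \<union> B) * f4 (A \<inter> B)"
  shows "sum f1 (Pow S) * sum f2 (Pow S) \<le> sum f3 (Pow S) * sum f4 (Pow S)"
  using assms
proof (induction S arbitrary: f1 f2 f3 f4 rule: finite_induct)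
  case empty
  then show ?case by simp
next
  case (insert x S)
  have split: "sum f (Pow (insert x S)) = (\<Sum>A\<in>Pow S. f A + f (insert x A))"
    for f :: "'a set \<Rightarrow> real"
  proof -
    have "sum f (Pow (insert x S)) = sum f (Pow S) + sum f (insert x ` Pow S)"
      unfolding Pow_insert using insert.hyps by (intro sum.union_disjoint) auto
    moreover have "inj_on (insert x) (Pow S)"
      using insert.hyps by (intro inj_onI) (metis PowD insert_ident subsetD)
    ultimately show ?thesis by (simp add: sum.reindex sum.distrib)
  qed
  show ?case unfolding split
  proof (rule insert.IH)
    fix A B assume AB: "A \<subseteq> S" "B \<subseteq> S"
    have sub: "A \<subseteq> insert x S" "B \<subseteq> insert x S" "insert x A \<subseteq> insert x S" "insert x B \<subseteq> insert x S"
      using AB by auto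
    \<comment> \<open>The new element lies in a union as soon as it lies in one set, but in an
      intersection only if it lies in both; this is the index pattern of the two-point case.\<close>
    have 1: "A \<union> insert x B = insert x (A \<union> B)" "insert x A \<union> B = insert x (A \<union> B)"
      "insert x A \<union> insert x B = insert x (A \<union> B)" "A \<inter> insert x B = A \<inter> B"
      "insert x A \<inter> B = A \<inter> B" "insert x A \<inter> insert x B = insert x (A \<inter> B)"
      using AB insert.hyps by auto
    show "(f1 A + f1 (insert x A)) * (f2 B + f2 (insert x B))
        \<le> (f3 (A \<union> B) + f3 (insert x (A \<union> B))) * (f4 (A \<inter> B) + f4 (insert x (A \<inter> B)))"
      using insert.prems(5)[OF sub(1) sub(2)] insert.prems(5)[OF sub(1) sub(4)]
        insert.prems(5)[OF sub(3) sub(2)] insert.prems(5)[OF sub(3) sub(4)] AB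
      unfolding 1 by (intro four_functions_two_point insert.prems(1-4)) auto
  qed (use insert.prems(1-4) in \<open>simp_all add: subset_insertI2 insert_mono\<close>)
qed

section \<open>Birkhoff representation of finite distributive lattices\<close>

text \<open>A predicate on sets, since the lattices in question are the set of trees and its finite
  principal ideals, inside the lattice of all partial maps.\<close>

definition sublattice :: "'a::lattice set \<Rightarrow> bool" where
  "sublattice L \<longleftrightarrow> (\<forall>x\<in>L. \<forall>y\<in>L. inf x y \<in> L \<and> sup x y \<in> L)"

text \<open>Each element is represented by the join-prime elements of \<open>L\<close> below it.
  Primality yields the law for \<open>sup\<close>; distributivity is what provides enough primes for
  injectivity.\<close>

lemma birkhoff_embedding:
  fixes L :: "'a::distrib_lattice set"
  assumes "finite L" "sublattice L"
  obtains h :: "'a \<Rightarrow> 'a set" where "inj_on h L" "\<And>x. x \<in> L \<Longrightarrow> h x \<subseteq> L"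
    "\<And>x y. x \<in> L \<Longrightarrow> y \<in> L \<Longrightarrow> h (inf x y) = h x \<inter> h y"
    "\<And>x y. x \<in> L \<Longrightarrow> y \<in> L \<Longrightarrow> h (sup x y) = h x \<union> h y"
proof -
  define J where "J = {j \<in> L. \<forall>a\<in>L. \<forall>b\<in>L. j \<le> sup a b \<longrightarrow> j \<le> a \<or> j \<le> b}"
  define h where "h x = {j \<in> J. j \<le> x}" for x
  have le: "x \<le> y" if "x \<in> L" "y \<in> L" "h x \<subseteq> h y" for x y
  proof (rule ccontr)
    assume "\<not> x \<le> y"
    \<comment> \<open>A minimal element of \<open>M\<close> will be join-prime, hence lie in
      \<open>h x\<close> but not in \<open>h y\<close>.\<close>
    define M where "M = {z \<in> L. z \<le> x \<and> \<not> z \<le> y}"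
    have "finite M" "M \<noteq> {}" using assms(1) that \<open>\<not> x \<le> y\<close> by (auto simp: M_def)
    then obtain z where "z \<in> M" "\<forall>w\<in>M. w \<le> z \<longrightarrow> z = w"
      using finite_has_minimal by blast
    then have z: "z \<in> L" "z \<le> x" "\<not> z \<le> y"
      and min: "\<And>w. w \<in> L \<Longrightarrow> w \<le> x \<Longrightarrow> \<not> w \<le> y \<Longrightarrow> w \<le> z \<Longrightarrow> w = z"
      by (auto simp: M_def)
    have "z \<le> a \<or> z \<le> b" if ab: "a \<in> L" "b \<in> L" "z \<le> sup a b" for a b
    proof (rule ccontr)
      assume "\<not> (z \<le> a \<or> z \<le> b)"
      \<comment> \<open>Both meets are strictly below \<open>z\<close>, so by minimality they lie
        below \<open>y\<close>; by distributivity so does \<open>inf z (sup a b)\<close>, which is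
        \<open>z\<close> itself.\<close>
      then have "inf z a \<noteq> z" "inf z b \<noteq> z" by (metis inf.cobounded2)+
      moreover have "inf z a \<in> L" "inf z b \<in> L" using assms(2) z ab by (auto simp: sublattice_def)
      moreover have "inf z a \<le> x" "inf z b \<le> x" using z by (auto intro: le_infI1)
      ultimately have "inf z a \<le> y" "inf z b \<le> y" using min by (meson inf.cobounded1)+
      then have "inf z (sup a b) \<le> y" by (simp add: inf_sup_distrib1)
      then show False using z ab by (simp add: inf.absorb1)
    qed
    then have "z \<in> h x" using z by (simp add: h_def J_def)
    then show False using that z by (auto simp: h_def)
  qed
  show thesis
  proof (rule that)
    show "inj_on h L" using le by (intro inj_onI order.antisym) auto
    show "h x \<subseteq> L" if "x \<in> L" for x by (auto simp: h_def J_def)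
    show "h (inf x y) = h x \<inter> h y" for x y by (auto simp: h_def)
    show "h (sup x y) = h x \<union> h y" if "x \<in> L" "y \<in> L" for x y
      using that by (auto simp: h_def J_def intro: le_supI1 le_supI2)
  qed
qed

section \<open>The FKG inequality on finite lattices\<close>

text \<open>The four functions are \<mu>F, \<mu>G, \<mu>FG and \<mu>, carried to the power set of
  \<open>L\<close> by the Birkhoff embedding. That theorem requires nonnegative functions, hence the
  sign conditions on \<open>F\<close> and \<open>G\<close>.\<close>

lemma fkg_finite_nonneg:
  fixes L :: "'a::distrib_lattice set" and \<mu> F G :: "'a \<Rightarrow> real"
  assumes "finite L" "sublattice L"
    and nonneg: "\<And>x. x \<in> L \<Longrightarrow> \<mu> x \<ge> 0" "\<And>x. x \<in> L \<Longrightarrow> F x \<ge> 0" "\<And>x. x \<in> L \<Longrightarrow> G x \<ge> 0"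
    and supermod: "\<And>x y. x \<in> L \<Longrightarrow> y \<in> L \<Longrightarrow> \<mu> x * \<mu> y \<le> \<mu> (inf x y) * \<mu> (sup x y)"
    and mono: "mono_on L F" "mono_on L G"
  shows "(\<Sum>x\<in>L. \<mu> x * F x) * (\<Sum>x\<in>L. \<mu> x * G x) \<le> (\<Sum>x\<in>L. \<mu> x * (F x * G x)) * sum \<mu> L"
proof -
  obtain h :: "'a \<Rightarrow> 'a set" where h: "inj_on h L" "\<And>x. x \<in> L \<Longrightarrow> h x \<subseteq> L"
    "\<And>x y. x \<in> L \<Longrightarrow> y \<in> L \<Longrightarrow> h (inf x y) = h x \<inter> h y"
    "\<And>x y. x \<in> L \<Longrightarrow> y \<in> L \<Longrightarrow> h (sup x y) = h x \<union> h y"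
    using birkhoff_embedding assms(1,2) by blast
  have closed: "inf x y \<in> L" "sup x y \<in> L" if "x \<in> L" "y \<in> L" for x y
    using assms(2) that by (auto simp: sublattice_def)
  \<comment> \<open>Extension by zero off the image of \<open>h\<close>: sums are unchanged, and if
    \<open>A\<close> or \<open>B\<close> is not in the image, the left side of the four functions
    hypothesis vanishes.\<close>
  define e where "e f A = (if A \<in> h ` L then f (the_inv_into L h A) else 0)"
    for f :: "'a \<Rightarrow> real" and A
  have e [simp]: "e f (h x) = f x" if "x \<in> L" for f x
    using that h(1) by (simp add: e_def the_inv_into_f_f)
  have e_nonneg: "e f A \<ge> 0" if "\<And>x. x \<in> L \<Longrightarrow> f x \<ge> 0" for f A
  proof (cases "A \<in> h ` L")
    case True
    then show ?thesis using that by auto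
  qed (simp add: e_def)
  have sum_e: "sum (e f) (Pow L) = sum f L" for f
  proof -
    have "sum (e f) (Pow L) = sum (e f) (h ` L)"
      using assms(1) h(2) by (intro sum.mono_neutral_right) (auto simp: e_def)
    also have "\<dots> = sum f L" using h(1) by (simp add: sum.reindex)
    finally show ?thesis .
  qed
  have main: "\<mu> x * F x * (\<mu> y * G y)
      \<le> \<mu> (sup x y) * (F (sup x y) * G (sup x y)) * \<mu> (inf x y)" if "x \<in> L" "y \<in> L" for x y
  proof -
    have "F x * G y \<le> F (sup x y) * G (sup x y)"
      using that closed mono nonneg by (intro mult_mono) (auto simp: mono_on_def)
    then have "(\<mu> x * \<mu> y) * (F x * G y)
        \<le> (\<mu> (inf x y) * \<mu> (sup x y)) * (F (sup x y) * G (sup x y))"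
      by (intro mult_mono[of "\<mu> x * \<mu> y"]) (use that closed nonneg supermod in auto)
    then show ?thesis by (simp add: algebra_simps)
  qed
  have "sum (e (\<lambda>x. \<mu> x * F x)) (Pow L) * sum (e (\<lambda>x. \<mu> x * G x)) (Pow L)
      \<le> sum (e (\<lambda>x. \<mu> x * (F x * G x))) (Pow L) * sum (e \<mu>) (Pow L)"
  proof (rule four_functions)
    fix A B
    show "e (\<lambda>x. \<mu> x * F x) A * e (\<lambda>x. \<mu> x * G x) B
        \<le> e (\<lambda>x. \<mu> x * (F x * G x)) (A \<union> B) * e \<mu> (A \<inter> B)"
    proof (cases "A \<in> h ` L \<and> B \<in> h ` L")
      case True
      then obtain x y where xy: "x \<in> L" "A = h x" "y \<in> L" "B = h y" by blast
      then have "A \<union> B = h (sup x y)" "A \<inter> B = h (inf x y)" using h(3,4) by auto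
      then show ?thesis using xy main closed by simp
    next
      case False
      then have "e (\<lambda>x. \<mu> x * F x) A * e (\<lambda>x. \<mu> x * G x) B = 0" by (auto simp: e_def)
      moreover have "0 \<le> e (\<lambda>x. \<mu> x * (F x * G x)) (A \<union> B) * e \<mu> (A \<inter> B)"
        using nonneg by (intro mult_nonneg_nonneg e_nonneg) auto
      ultimately show ?thesis by linarith
    qed
  qed (use assms(1) nonneg in \<open>auto intro!: e_nonneg\<close>)
  then show ?thesis by (simp add: sum_e)
qed

text \<open>Adding constants to \<open>F\<close> and \<open>G\<close> does not change the
  inequality, and on a finite set suitable constants make both nonnegative.\<close>

lemma fkg_finite:
  fixes L :: "'a::distrib_lattice set" and \<mu> F G :: "'a \<Rightarrow> real"
  assumes "finite L" "sublattice L"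
    and "\<And>x. x \<in> L \<Longrightarrow> \<mu> x \<ge> 0"
    and "\<And>x y. x \<in> L \<Longrightarrow> y \<in> L \<Longrightarrow> \<mu> x * \<mu> y \<le> \<mu> (inf x y) * \<mu> (sup x y)"
    and mono: "mono_on L F" "mono_on L G"
  shows "(\<Sum>x\<in>L. \<mu> x * F x) * (\<Sum>x\<in>L. \<mu> x * G x) \<le> (\<Sum>x\<in>L. \<mu> x * (F x * G x)) * sum \<mu> L"
proof -
  have "\<exists>c. \<forall>x\<in>L. H x + c \<ge> 0" for H :: "'a \<Rightarrow> real"
  proof -
    have "H x + (\<Sum>y\<in>L. \<bar>H y\<bar>) \<ge> 0" if "x \<in> L" for x
      using member_le_sum[OF that, of "\<lambda>y. \<bar>H y\<bar>"] assms(1) by simp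
    then show ?thesis by blast
  qed
  from this[of F] this[of G] obtain c d
    where cd: "\<And>x. x \<in> L \<Longrightarrow> F x + c \<ge> 0" "\<And>x. x \<in> L \<Longrightarrow> G x + d \<ge> 0"
    by blast
  have "(\<Sum>x\<in>L. \<mu> x * (F x + c)) * (\<Sum>x\<in>L. \<mu> x * (G x + d))
      \<le> (\<Sum>x\<in>L. \<mu> x * ((F x + c) * (G x + d))) * sum \<mu> L"
    using assms cd by (intro fkg_finite_nonneg) (auto simp: mono_on_def)
  \<comment> \<open>After expansion, the terms containing \<open>c\<close> or \<open>d\<close> are
    the same on both sides and cancel.\<close>
  moreover have "(\<Sum>x\<in>L. \<mu> x * (F x + c)) = (\<Sum>x\<in>L. \<mu> x * F x) + c * sum \<mu> L"
    "(\<Sum>x\<in>L. \<mu> x * (G x + d)) = (\<Sum>x\<in>L. \<mu> x * G x) + d * sum \<mu> L"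
    "(\<Sum>x\<in>L. \<mu> x * ((F x + c) * (G x + d))) = (\<Sum>x\<in>L. \<mu> x * (F x * G x))
       + d * (\<Sum>x\<in>L. \<mu> x * F x) + c * (\<Sum>x\<in>L. \<mu> x * G x) + c * d * sum \<mu> L"
    by (simp_all add: sum_distrib_left sum.distrib algebra_simps)
  ultimately show ?thesis by (simp add: algebra_simps)
qed

section \<open>Passage to infinite sums\<close>

text \<open>Every nonempty finite subset of \<open>L\<close> lies in a principal ideal, which is a
  finite sublattice. A violation in the limit would therefore already appear on such an ideal,
  against the finite case.\<close>

lemma fkg_finite_ideals:
  fixes L :: "'a::distrib_lattice set" and \<mu> F G :: "'a \<Rightarrow> real"
  assumes L: "sublattice L" "\<And>x. x \<in> L \<Longrightarrow> finite {y \<in> L. y \<le> x}"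
    and \<mu>: "\<And>x. x \<in> L \<Longrightarrow> \<mu> x \<ge> 0"
    "\<And>x y. x \<in> L \<Longrightarrow> y \<in> L \<Longrightarrow> \<mu> x * \<mu> y \<le> \<mu> (inf x y) * \<mu> (sup x y)"
    and mono: "mono_on L F" "mono_on L G"
    and sums: "\<mu> summable_on L" "(\<lambda>x. \<mu> x * F x) summable_on L" "(\<lambda>x. \<mu> x * G x) summable_on L"
    "(\<lambda>x. \<mu> x * (F x * G x)) summable_on L"
  shows "(\<Sum>\<^sub>\<infinity>x\<in>L. \<mu> x * F x) * (\<Sum>\<^sub>\<infinity>x\<in>L. \<mu> x * G x)
    \<le> (\<Sum>\<^sub>\<infinity>x\<in>L. \<mu> x * (F x * G x)) * infsum \<mu> L"
proof (rule ccontr)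
  \<comment> \<open>The defect on a finite set; it converges along finite subsets of
    \<open>L\<close> to the defect of the infinite sums.\<close>
  define D where "D X = (\<Sum>x\<in>X. \<mu> x * F x) * (\<Sum>x\<in>X. \<mu> x * G x)
    - (\<Sum>x\<in>X. \<mu> x * (F x * G x)) * sum \<mu> X" for X
  let ?d = "(\<Sum>\<^sub>\<infinity>x\<in>L. \<mu> x * F x) * (\<Sum>\<^sub>\<infinity>x\<in>L. \<mu> x * G x)
    - (\<Sum>\<^sub>\<infinity>x\<in>L. \<mu> x * (F x * G x)) * infsum \<mu> L"
  assume "\<not> ?thesis"
  then have "?d > 0" by simp
  moreover have "(D \<longlongrightarrow> ?d) (finite_subsets_at_top L)"
    unfolding D_def using sums by (intro tendsto_intros infsum_tendsto)
  ultimately have "\<forall>\<^sub>F X in finite_subsets_at_top L. D X > 0"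
    by (rule order_tendstoD(1)[rotated])
  then obtain X where X: "finite X" "X \<subseteq> L" "\<And>Y. finite Y \<Longrightarrow> X \<subseteq> Y \<Longrightarrow> Y \<subseteq> L \<Longrightarrow> D Y > 0"
    by (auto simp: eventually_finite_subsets_at_top)
  show False
  proof (cases "X = {}")
    case True
    then show False using X(3)[of "{}"] by (simp add: D_def)
  next
    case False
    \<comment> \<open>The bound is the join of all elements of \<open>X\<close>; the empty set was
      split off because \<open>L\<close> need not have an element.\<close>
    have "\<exists>u\<in>L. \<forall>x\<in>X. x \<le> u" using X(1) False X(2)
    proof (induction rule: finite_ne_induct)
      case (insert x X)
      then obtain u where "u \<in> L" "\<forall>y\<in>X. y \<le> u" by auto
      then show ?case using insert.prems L(1)
        by (intro bexI[of _ "sup x u"]) (auto simp: sublattice_def intro: le_supI2)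
    qed auto
    then obtain u where u: "u \<in> L" "\<forall>x\<in>X. x \<le> u" by blast
    define Y where "Y = {y \<in> L. y \<le> u}"
    have Y: "finite Y" "X \<subseteq> Y" "Y \<subseteq> L" using L(2) u X(2) by (auto simp: Y_def)
    have "sublattice Y" using L(1) by (auto simp: sublattice_def Y_def intro: le_infI1)
    with Y(1) have "(\<Sum>x\<in>Y. \<mu> x * F x) * (\<Sum>x\<in>Y. \<mu> x * G x)
        \<le> (\<Sum>x\<in>Y. \<mu> x * (F x * G x)) * sum \<mu> Y"
      by (rule fkg_finite)
        (use Y(3) in \<open>blast intro: \<mu> mono_on_subset[OF mono(1)] mono_on_subset[OF mono(2)]\<close>)+
    then show False using X(3)[OF Y] by (simp add: D_def)
  qed
qed

section \<open>The lattice of trees\<close>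

text \<open>\<open>None\<close> is the least element of the option order and plays the part of the
  spin -1.\<close>

lemma dom_inf: "dom (inf \<omega> \<omega>') = dom \<omega> \<inter> dom \<omega>'"
  for \<omega> \<omega>' :: "'a \<Rightarrow> 'b::lattice option"
proof -
  have "inf \<omega> \<omega>' i \<noteq> None \<longleftrightarrow> \<omega> i \<noteq> None \<and> \<omega>' i \<noteq> None" for i
    by (cases "\<omega> i"; cases "\<omega>' i") auto
  then show ?thesis by (simp add: dom_def set_eq_iff)
qed

lemma dom_sup: "dom (sup \<omega> \<omega>') = dom \<omega> \<union> dom \<omega>'"
  for \<omega> \<omega>' :: "'a \<Rightarrow> 'b::lattice option"
proof -
  have "sup \<omega> \<omega>' i \<noteq> None \<longleftrightarrow> \<omega> i \<noteq> None \<or> \<omega>' i \<noteq> None" for i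
    by (cases "\<omega> i"; cases "\<omega>' i") auto
  then show ?thesis by (simp add: dom_def set_eq_iff)
qed

lemma child_in_tree_iff:
  assumes "\<omega> \<in> trees n" "i @ [j] \<in> labels n"
  shows "i @ [j] \<in> dom \<omega> \<longleftrightarrow> (\<exists>k. \<omega> i = Some k \<and> j \<le> k)"
  using assms by (auto simp: trees_def)

text \<open>Presence of the \<open>j\<close>-th child is the threshold condition that the spin of
  the parent be at least \<open>j\<close>. A minimum reaches a threshold iff both spins do, a
  maximum iff one of them does.\<close>

lemma sublattice_trees: "sublattice (trees n)"
proof -
  have "inf \<omega> \<omega>' \<in> trees n" "sup \<omega> \<omega>' \<in> trees n" if "\<omega> \<in> trees n" "\<omega>' \<in> trees n" for \<omega> \<omega>'
  proof -
    have base: "[] \<in> dom \<omega>" "[] \<in> dom \<omega>'" "dom \<omega> \<subseteq> labels n" "dom \<omega>' \<subseteq> labels n"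
      using that by (simp_all add: trees_def)
    have inf: "(\<exists>k. inf \<omega> \<omega>' i = Some k \<and> j \<le> k) \<longleftrightarrow>
        (\<exists>k. \<omega> i = Some k \<and> j \<le> k) \<and> (\<exists>k. \<omega>' i = Some k \<and> j \<le> k)" for i and j :: nat
      by (cases "\<omega> i"; cases "\<omega>' i") (auto simp: inf_nat_def)
    have sup: "(\<exists>k. sup \<omega> \<omega>' i = Some k \<and> j \<le> k) \<longleftrightarrow>
        (\<exists>k. \<omega> i = Some k \<and> j \<le> k) \<or> (\<exists>k. \<omega>' i = Some k \<and> j \<le> k)" for i and j :: nat
      by (cases "\<omega> i"; cases "\<omega>' i") (auto simp: sup_nat_def)
    have "i @ [j] \<in> dom (inf \<omega> \<omega>') \<longleftrightarrow> (\<exists>k. inf \<omega> \<omega>' i = Some k \<and> j \<le> k)"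
      "i @ [j] \<in> dom (sup \<omega> \<omega>') \<longleftrightarrow> (\<exists>k. sup \<omega> \<omega>' i = Some k \<and> j \<le> k)"
      if "i @ [j] \<in> labels n" for i j
      unfolding inf sup dom_inf dom_sup Int_iff Un_iff
      using child_in_tree_iff[OF _ that] \<open>\<omega> \<in> trees n\<close> \<open>\<omega>' \<in> trees n\<close> by simp_all
    moreover have "[] \<in> dom (inf \<omega> \<omega>')" "[] \<in> dom (sup \<omega> \<omega>')"
      "dom (inf \<omega> \<omega>') \<subseteq> labels n" "dom (sup \<omega> \<omega>') \<subseteq> labels n"
      using base unfolding dom_inf dom_sup by blast+
    ultimately show "inf \<omega> \<omega>' \<in> trees n" "sup \<omega> \<omega>' \<in> trees n"
      unfolding trees_def by blast+
  qed
  then show ?thesis by (simp add: sublattice_def)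
qed

lemma finite_maps_below:
  fixes \<tau> :: "'a \<Rightarrow> nat option"
  assumes "finite (dom \<tau>)"
  shows "finite {\<omega>. \<omega> \<le> \<tau>}"
proof (rule finite_subset)
  \<comment> \<open>One finite set containing every value that a map below \<tau> can take; its
    domain is a subset of \<open>dom \<tau>\<close>.\<close>
  define B where "B = (\<Union>i\<in>dom \<tau>. {..the (\<tau> i)})"
  show "{\<omega>. \<omega> \<le> \<tau>} \<subseteq> (\<Union>A\<in>Pow (dom \<tau>). {\<omega>. dom \<omega> = A \<and> ran \<omega> \<subseteq> B})"
  proof
    fix \<omega> assume "\<omega> \<in> {\<omega>. \<omega> \<le> \<tau>}"
    then have "\<omega> i \<le> \<tau> i" for i by (simp add: le_fun_def)
    then have le: "\<exists>m. \<tau> i = Some m \<and> k \<le> m" if "\<omega> i = Some k" for i k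
      using that by (metis less_eq_option_Some less_eq_option_Some_None option.exhaust)
    then have "dom \<omega> \<subseteq> dom \<tau>" by blast
    moreover have "ran \<omega> \<subseteq> B" unfolding B_def ran_def using le by force
    ultimately show "\<omega> \<in> (\<Union>A\<in>Pow (dom \<tau>). {\<omega>. dom \<omega> = A \<and> ran \<omega> \<subseteq> B})" by blast
  qed
  show "finite (\<Union>A\<in>Pow (dom \<tau>). {\<omega>. dom \<omega> = A \<and> ran \<omega> \<subseteq> B})"
    using assms by (auto simp: B_def intro!: finite_set_of_finite_maps intro: finite_subset)
qed

lemma tree_config_in_configs: "tree_config n \<omega> \<in> configs n"
  by (auto simp: tree_config_def configs_def)

text \<open>Absent nodes get -1, below every offspring number, so the order of partial maps becomes
  the pointwise order of spins.\<close>

lemma tree_config_mono: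
  assumes "\<omega> \<le> \<omega>'"
  shows "config_le n (tree_config n \<omega>) (tree_config n \<omega>')"
  unfolding config_le_def
proof
  fix i assume i: "i \<in> labels n"
  have "\<omega> i \<le> \<omega>' i" using assms by (simp add: le_fun_def)
  then show "tree_config n \<omega> i \<le> tree_config n \<omega>' i"
    using i by (cases "\<omega> i"; cases "\<omega>' i") (auto simp: tree_config_def offspring_def)
qed

lemma mono_on_tree_config:
  fixes F :: "(nat list \<Rightarrow> int) \<Rightarrow> real"
  assumes "monotone_on (configs n) (config_le n) (\<le>) F"
  shows "mono_on A (\<lambda>\<omega>. F (tree_config n \<omega>))"
  using assms
  by (auto simp: monotone_on_def tree_config_in_configs tree_config_mono)

section \<open>Log-supermodularity of the Boltzmann weight\<close>

lemma offspring_inf: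
  "i \<in> dom \<omega> \<Longrightarrow> i \<in> dom \<omega>' \<Longrightarrow> offspring (inf \<omega> \<omega>') i = min (offspring \<omega> i) (offspring \<omega>' i)"
  by (auto simp: offspring_def inf_nat_def)

lemma offspring_sup:
  "i \<in> dom \<omega> \<Longrightarrow> i \<in> dom \<omega>' \<Longrightarrow> offspring (sup \<omega> \<omega>') i = max (offspring \<omega> i) (offspring \<omega>' i)"
  by (auto simp: offspring_def sup_nat_def)

lemma offspring_sup_left: "i \<notin> dom \<omega>' \<Longrightarrow> offspring (sup \<omega> \<omega>') i = offspring \<omega> i"
  by (cases "\<omega> i") (auto simp: offspring_def dom_def)

lemma parent_in_tree:
  assumes "\<omega> \<in> trees n" "i \<in> dom \<omega>" "i \<noteq> []"
  shows "butlast i \<in> dom \<omega>" "last i \<le> offspring \<omega> (butlast i)"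
proof -
  have "butlast i @ [last i] \<in> labels n" "butlast i @ [last i] \<in> dom \<omega>"
    using assms by (auto simp: trees_def)
  then obtain k where "\<omega> (butlast i) = Some k" "last i \<le> k"
    using child_in_tree_iff[OF assms(1)] by blast
  then show "butlast i \<in> dom \<omega>" "last i \<le> offspring \<omega> (butlast i)"
    by (auto simp: offspring_def)
qed

lemma parent_offspring_inf:
  assumes "\<omega> \<in> trees n" "\<omega>' \<in> trees n" "i \<in> dom \<omega>" "i \<in> dom \<omega>'"
  shows "parent_offspring x (inf \<omega> \<omega>') i
    = min (parent_offspring x \<omega> i) (parent_offspring x \<omega>' i)"
  using assms by (auto simp: parent_offspring_def offspring_inf parent_in_tree)

lemma parent_offspring_sup:
  assumes "\<omega> \<in> trees n" "\<omega>' \<in> trees n" "i \<in> dom \<omega>" "i \<in> dom \<omega>'"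
  shows "parent_offspring x (sup \<omega> \<omega>') i
    = max (parent_offspring x \<omega> i) (parent_offspring x \<omega>' i)"
  using assms by (auto simp: parent_offspring_def offspring_sup parent_in_tree)

lemma parent_offspring_sup_left:
  assumes "\<omega> \<in> trees n" "\<omega>' \<in> trees n" "i \<in> dom \<omega>" "i \<notin> dom \<omega>'"
  shows "parent_offspring x (sup \<omega> \<omega>') i = parent_offspring x \<omega> i"
proof (cases "i = []")
  case True
  then show ?thesis by (simp add: parent_offspring_def)
next
  case False
  note par = parent_in_tree[OF assms(1,3) False]
  show ?thesis
  proof (cases "butlast i \<in> dom \<omega>'")
    case True
    \<comment> \<open>As \<open>i\<close> is an admissible label, its absence from \<omega>' means
      that the parent has fewer than \<open>last i\<close> children there, whereas in \<omega> it
      has at least that many.\<close>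
    have "butlast i @ [last i] \<in> labels n" "butlast i @ [last i] \<notin> dom \<omega>'"
      using assms False by (auto simp: trees_def)
    then have "offspring \<omega>' (butlast i) < last i"
      using child_in_tree_iff[OF assms(2)] True by (auto simp: offspring_def)
    then show ?thesis using False True par
      by (simp add: parent_offspring_def offspring_sup)
  qed (use False in \<open>simp add: parent_offspring_def offspring_sup_left\<close>)
qed

text \<open>At a common node, minimum and maximum merely rearrange the two offspring numbers; at a
  node of one tree only, the join keeps its number. The factors on both sides are thus the
  same.\<close>

lemma GW_weight_inf_sup:
  assumes "finite (dom \<omega>)" "finite (dom \<omega>')"
  shows "GW_weight p (inf \<omega> \<omega>') * GW_weight p (sup \<omega> \<omega>') = GW_weight p \<omega> * GW_weight p \<omega>'"
proof -
  define D where "D = dom \<omega> \<union> dom \<omega>'"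
  \<comment> \<open>The factor 1 at absent nodes lets all four products run over
    \<open>D\<close>.\<close>
  define g where "g \<tau> i = (if i \<in> dom \<tau> then pmf p (offspring \<tau> i) else 1)"
    for \<tau> :: "nat list \<rightharpoonup> nat" and i
  have eq: "GW_weight p \<tau> = prod (g \<tau>) D" if "dom \<tau> \<subseteq> D" for \<tau>
    unfolding GW_weight_def using that assms
    by (intro prod.mono_neutral_cong_left) (auto simp: D_def g_def)
  have "g (inf \<omega> \<omega>') i * g (sup \<omega> \<omega>') i = g \<omega> i * g \<omega>' i" for i
  proof (cases "i \<in> dom \<omega> \<and> i \<in> dom \<omega>'")
    case True
    then show ?thesis
      by (cases "offspring \<omega> i \<le> offspring \<omega>' i")
        (simp_all add: g_def dom_inf dom_sup offspring_inf offspring_sup min_def max_def)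
  next
    case False
    then show ?thesis
      using offspring_sup_left[of i \<omega>' \<omega>] offspring_sup_left[of i \<omega> \<omega>']
      unfolding g_def dom_inf dom_sup by (auto simp: sup.commute)
  qed
  then have "prod (g (inf \<omega> \<omega>')) D * prod (g (sup \<omega> \<omega>')) D = prod (g \<omega>) D * prod (g \<omega>') D"
    by (simp flip: prod.distrib)
  moreover have "dom (inf \<omega> \<omega>') \<subseteq> D" "dom (sup \<omega> \<omega>') \<subseteq> D" "dom \<omega> \<subseteq> D" "dom \<omega>' \<subseteq> D"
    unfolding D_def dom_inf dom_sup by auto
  ultimately show ?thesis by (simp only: eq)
qed

text \<open>Compared node by node: at a common node this is the hypothesis on \<phi>; at a node of
  one tree only, the meet contributes nothing and the join keeps the spins of both the node and its
  parent, giving equality.\<close>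

lemma energy_inf_sup_le:
  assumes \<phi>: "\<And>X Y X' Y'. X \<in> {-1..} \<Longrightarrow> Y \<in> {-1..} \<Longrightarrow> X' \<in> {-1..} \<Longrightarrow> Y' \<in> {-1..} \<Longrightarrow>
      \<phi> X Y + \<phi> X' Y' \<ge> \<phi> (min X X') (min Y Y') + \<phi> (max X X') (max Y Y')"
    and trees: "\<omega> \<in> trees n" "\<omega>' \<in> trees n"
  shows "energy \<phi> x (inf \<omega> \<omega>') + energy \<phi> x (sup \<omega> \<omega>') \<le> energy \<phi> x \<omega> + energy \<phi> x \<omega>'"
proof -
  define D where "D = dom \<omega> \<union> dom \<omega>'"
  have D: "finite D" using trees finite_dom_tree by (auto simp: D_def)
  define g where "g \<tau> i =
      (if i \<in> dom \<tau> then \<phi> (int (parent_offspring x \<tau> i)) (int (offspring \<tau> i)) else 0)" for \<tau> i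
  have eq: "energy \<phi> x \<tau> = sum (g \<tau>) D" if "dom \<tau> \<subseteq> D" for \<tau>
    unfolding energy_def using that D
    by (intro sum.mono_neutral_cong_left) (auto simp: g_def)
  have one: "g (sup \<tau> \<tau>') i = g \<tau> i"
    if "\<tau> \<in> trees n" "\<tau>' \<in> trees n" "i \<in> dom \<tau>" "i \<notin> dom \<tau>'" for \<tau> \<tau>' i
    using that by (simp add: g_def dom_sup offspring_sup_left parent_offspring_sup_left)
  have "g (inf \<omega> \<omega>') i + g (sup \<omega> \<omega>') i \<le> g \<omega> i + g \<omega>' i" if i: "i \<in> D" for i
  proof -
    consider "i \<in> dom \<omega>" "i \<in> dom \<omega>'" | "i \<in> dom \<omega>" "i \<notin> dom \<omega>'" | "i \<notin> dom \<omega>" "i \<in> dom \<omega>'"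
      using i unfolding D_def by blast
    then show ?thesis
    proof cases
      case 1
      then have "i \<in> dom (inf \<omega> \<omega>')" "i \<in> dom (sup \<omega> \<omega>')" by (simp_all only: dom_inf dom_sup) auto
      with 1 show ?thesis
        unfolding g_def
        by (simp only: if_True offspring_inf offspring_sup parent_offspring_inf[OF trees]
            parent_offspring_sup[OF trees] of_nat_min of_nat_max) (intro \<phi>, auto)
    next
      case 2
      then have "i \<notin> dom (inf \<omega> \<omega>')" by (simp only: dom_inf) auto
      then show ?thesis using one[OF trees 2] 2 by (simp only: g_def) simp
    next
      case 3
      then have "i \<notin> dom (inf \<omega> \<omega>')" by (simp only: dom_inf) auto
      then show ?thesis using one[OF trees(2,1) 3(2,1)] 3 by (simp only: g_def sup.commute) simp
    qed
  qed
  then have "sum (g (inf \<omega> \<omega>')) D + sum (g (sup \<omega> \<omega>')) D \<le> sum (g \<omega>) D + sum (g \<omega>') D"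
    unfolding sum.distrib[symmetric] by (rule sum_mono)
  moreover have "dom (inf \<omega> \<omega>') \<subseteq> D" "dom (sup \<omega> \<omega>') \<subseteq> D" "dom \<omega> \<subseteq> D" "dom \<omega>' \<subseteq> D"
    unfolding D_def dom_inf dom_sup by auto
  ultimately show ?thesis by (simp only: eq)
qed

lemma boltzmann_weight_nonneg: "boltzmann_weight p \<phi> \<beta> x \<omega> \<ge> 0"
  by (simp add: boltzmann_weight_def GW_weight_def prod_nonneg)

text \<open>The Galton-Watson factors agree, and since \<beta> is nonnegative the exponential
  reverses the inequality between the energies.\<close>

lemma boltzmann_weight_supermodular:
  assumes \<phi>: "\<And>X Y X' Y'. X \<in> {-1..} \<Longrightarrow> Y \<in> {-1..} \<Longrightarrow> X' \<in> {-1..} \<Longrightarrow> Y' \<in> {-1..} \<Longrightarrow>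
      \<phi> X Y + \<phi> X' Y' \<ge> \<phi> (min X X') (min Y Y') + \<phi> (max X X') (max Y Y')"
    and "\<beta> \<ge> 0" and trees: "\<omega> \<in> trees n" "\<omega>' \<in> trees n"
  shows "boltzmann_weight p \<phi> \<beta> x \<omega> * boltzmann_weight p \<phi> \<beta> x \<omega>'
    \<le> boltzmann_weight p \<phi> \<beta> x (inf \<omega> \<omega>') * boltzmann_weight p \<phi> \<beta> x (sup \<omega> \<omega>')"
proof -
  let ?E = "energy \<phi> x" and ?W = "GW_weight p"
  have prod: "boltzmann_weight p \<phi> \<beta> x \<tau> * boltzmann_weight p \<phi> \<beta> x \<tau>'
      = (?W \<tau> * ?W \<tau>') * exp (- (\<beta> * (?E \<tau> + ?E \<tau>')))" for \<tau> \<tau>'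
    by (simp add: boltzmann_weight_def exp_add[symmetric] algebra_simps)
  have "\<beta> * (?E (inf \<omega> \<omega>') + ?E (sup \<omega> \<omega>')) \<le> \<beta> * (?E \<omega> + ?E \<omega>')"
    using energy_inf_sup_le[of \<phi>, OF \<phi> trees] \<open>\<beta> \<ge> 0\<close> by (rule mult_left_mono)
  moreover have "?W \<omega> * ?W \<omega>' \<ge> 0" by (simp add: GW_weight_def prod_nonneg)
  ultimately show ?thesis
    unfolding prod GW_weight_inf_sup[OF finite_dom_tree[OF trees(1)] finite_dom_tree[OF trees(2)]]
    by (intro mult_left_mono) auto
qed

section \<open>Normalisation and the correlation inequality for trees\<close>

theorem theorem3:
  fixes p :: "nat pmf" and n x :: nat and \<beta> :: real
    and \<phi> :: "int \<Rightarrow> int \<Rightarrow> real"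
    and F G :: "(nat list \<Rightarrow> int) \<Rightarrow> real"
  assumes "pmf p 0 > 0" and "pmf p 0 + pmf p 1 < 1"
    and "x \<ge> 1" and "\<beta> \<ge> 0"
    and "\<And>X Y X' Y'. X \<in> {-1..} \<Longrightarrow> Y \<in> {-1..} \<Longrightarrow> X' \<in> {-1..} \<Longrightarrow> Y' \<in> {-1..} \<Longrightarrow>
           \<phi> X Y + \<phi> X' Y' \<ge> \<phi> (min X X') (min Y Y') + \<phi> (max X X') (max Y Y')"
    and "finite_partition_function p \<phi> \<beta> n x"
    and "monotone_on (configs n) (config_le n) (\<le>) F"
    and "monotone_on (configs n) (config_le n) (\<le>) G"
    and "tree_integrable p \<phi> \<beta> n x F"
    and "tree_integrable p \<phi> \<beta> n x G"
    and "tree_integrable p \<phi> \<beta> n x (\<lambda>\<sigma>. F \<sigma> * G \<sigma>)"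
  shows "tree_expectation p \<phi> \<beta> n x (\<lambda>\<sigma>. F \<sigma> * G \<sigma>)
           - tree_expectation p \<phi> \<beta> n x F * tree_expectation p \<phi> \<beta> n x G \<ge> 0"
proof -
  define Z where "Z = partition_function p \<phi> \<beta> n x"
  define \<mu> where "\<mu> = tree_prob p \<phi> \<beta> n x"
  have \<mu>': "\<mu> = (\<lambda>\<omega>. boltzmann_weight p \<phi> \<beta> x \<omega> * inverse Z)"
    by (simp add: fun_eq_iff \<mu>_def tree_prob_def Z_def divide_inverse)
  then have \<mu>: "\<mu> \<omega> = boltzmann_weight p \<phi> \<beta> x \<omega> / Z" for \<omega>
    by (simp add: divide_inverse)
  have "Z \<ge> 0"
    by (simp add: Z_def partition_function_def infsum_nonneg boltzmann_weight_nonneg)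
  show ?thesis
  proof (cases "Z = 0")
    case True
    \<comment> \<open>Division by zero gives zero, so all three expectations vanish.\<close>
    then have "\<mu> \<omega> = 0" for \<omega> by (simp add: \<mu>)
    then show ?thesis by (simp add: tree_expectation_def flip: \<mu>_def)
  next
    case False
    have weight: "boltzmann_weight p \<phi> \<beta> x summable_on trees n"
      using assms(6) by (simp add: finite_partition_function_def)
    then have summable: "\<mu> summable_on trees n"
      unfolding \<mu>' by (rule summable_on_cmult_left)
    have "infsum \<mu> (trees n) = Z * inverse Z"
      unfolding \<mu>' using weight
      by (subst infsum_cmult_left) (auto simp: Z_def partition_function_def)
    \<comment> \<open>Total mass one removes the last factor of the lattice inequality and leaves
      the covariance.\<close>
    then have total: "infsum \<mu> (trees n) = 1" using False by simp
    have "(\<Sum>\<^sub>\<infinity>\<omega>\<in>trees n. \<mu> \<omega> * F (tree_config n \<omega>)) * (\<Sum>\<^sub>\<infinity>\<omega>\<in>trees n. \<mu> \<omega> * G (tree_config n \<omega>))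
      \<le> (\<Sum>\<^sub>\<infinity>\<omega>\<in>trees n. \<mu> \<omega> * (F (tree_config n \<omega>) * G (tree_config n \<omega>))) * infsum \<mu> (trees n)"
    proof (rule fkg_finite_ideals)
      show "finite {\<omega> \<in> trees n. \<omega> \<le> \<tau>}" if "\<tau> \<in> trees n" for \<tau>
        using finite_maps_below[OF finite_dom_tree[OF that]] by (rule rev_finite_subset) auto
      show "\<mu> \<omega> \<ge> 0" for \<omega>
        using \<open>Z \<ge> 0\<close> by (simp add: \<mu> boltzmann_weight_nonneg)
      \<comment> \<open>Both sides are products of two weights divided by the square of
        \<open>Z\<close>.\<close>
      show "\<mu> \<omega> * \<mu> \<omega>' \<le> \<mu> (inf \<omega> \<omega>') * \<mu> (sup \<omega> \<omega>')"
        if "\<omega> \<in> trees n" "\<omega>' \<in> trees n" for \<omega> \<omega>'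
        using boltzmann_weight_supermodular[of \<phi>, OF assms(5) assms(4) that, of p x] \<open>Z \<ge> 0\<close>
        by (simp add: \<mu> divide_right_mono)
    qed (use assms(7-11) summable in
        \<open>simp_all add: sublattice_trees mono_on_tree_config tree_integrable_def \<mu>_def\<close>)
    then show ?thesis by (simp add: total tree_expectation_def flip: \<mu>_def)
  qed
qed

end
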